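(* Consider vectors $l,u\in\mathbb{R}^d$. Let $F,G\subseteq\mathbb{R}^d\times\mathbb{S}^{d\times d}$ be defined by $$ F=\{(z,M)\mid l\le z\le u,\; M=zz^T\}, $$ $$ G=\left\{(z,M)\;\middle|\; \begin{array}{l} uz^T-ul^T-M+zl^T\ge 0,\\ uu^T-uz^T-zu^T+M\ge 0,\\ M-zl^T-lz^T+ll^T\ge 0, \end{array} \quad \begin{bmatrix}M & z\\ z^T & 1\end{bmatrix}\succeq 0 \right\}, $$ where the matrix inequalities $\ge$ are taken elementwise. Then $F\subseteq G$.
   Context: $\mathbb{S}^{d\times d}$ denotes the set of real symmetric $d\times d$ matrices, and $\succeq 0$ means positive semidefinite. Vector inequalities are component-wise. *)

theory Defs
  imports "HOL-Analysis.Analysis"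
begin

definition symmetric_matrices :: "(real ^ 'n ^ 'n) set" where
  "symmetric_matrices = {A. transpose A = A}"

definition pos_semidef :: "real ^ 'n ^ 'n \<Rightarrow> bool" where
  "pos_semidef A \<longleftrightarrow> A \<in> symmetric_matrices \<and> (\<forall>x. 0 \<le> x \<bullet> (A *v x))"

text \<open>The matrix \<open>x y\<^sup>T\<close>, as the product of a column (one column, indexed by the type \<open>1\<close>) and a row.\<close>

definition outer_product :: "real ^ 'm \<Rightarrow> real ^ 'n \<Rightarrow> real ^ 'n ^ 'm" where
  "outer_product x y = (columnvector x :: real ^ 1 ^ 'm) ** (rowvector y :: real ^ 'n ^ 1)"

text \<open>The block matrix with rows \<open>A B\<close> and \<open>C D\<close>. In \<open>real ^ 'n ^ 'm\<close> the outer index \<open>'m\<close>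
  counts the rows.\<close>

definition block_matrix ::
  "real ^ 'n ^ 'm \<Rightarrow> real ^ 'q ^ 'm \<Rightarrow> real ^ 'n ^ 'p \<Rightarrow> real ^ 'q ^ 'p \<Rightarrow> real ^ ('n + 'q) ^ ('m + 'p)"
where
  "block_matrix A B C D =
    (\<chi> i j. case i of
        Inl i' \<Rightarrow> (case j of Inl j' \<Rightarrow> A $ i' $ j' | Inr j' \<Rightarrow> B $ i' $ j')
      | Inr i' \<Rightarrow> (case j of Inl j' \<Rightarrow> C $ i' $ j' | Inr j' \<Rightarrow> D $ i' $ j'))"

definition lifted_set :: "real ^ 'd \<Rightarrow> real ^ 'd \<Rightarrow> ((real ^ 'd) \<times> (real ^ 'd ^ 'd)) set" where
  "lifted_set l u =
    {(z, M). M \<in> symmetric_matrices \<and> l \<le> z \<and> z \<le> u \<and> M = outer_product z z}"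

text \<open>The order on \<open>real ^ 'd ^ 'd\<close> is the componentwise order of vectors applied twice, so
  \<open>0 \<le> A\<close> says that every entry of \<open>A\<close> is nonnegative.\<close>

definition relaxed_set :: "real ^ 'd \<Rightarrow> real ^ 'd \<Rightarrow> ((real ^ 'd) \<times> (real ^ 'd ^ 'd)) set" where
  "relaxed_set l u =
    {(z, M). M \<in> symmetric_matrices \<and>
      outer_product u z - outer_product u l - M + outer_product z l \<ge> 0 \<and>
      outer_product u u - outer_product u z - outer_product z u + M \<ge> 0 \<and>
      M - outer_product z l - outer_product l z + outer_product l l \<ge> 0 \<and>
      pos_semidef (block_matrix M (columnvector z :: real ^ 1 ^ 'd)
                                (rowvector z :: real ^ 'd ^ 1) (mat 1 :: real ^ 1 ^ 1))}"

end

theory Submission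
  imports Defs
begin

text \<open>On the lifted set every constraint of the relaxed set is about a matrix of rank at most one.
  With \<open>M = z z\<^sup>T\<close>, the three linear expressions factor as \<open>(u - z) (z - l)\<^sup>T\<close>,
  \<open>(u - z) (u - z)\<^sup>T\<close> and \<open>(z - l) (z - l)\<^sup>T\<close>. Their factors are componentwise nonnegative because
  \<open>l \<le> z \<le> u\<close>, so all entries are nonnegative. The block matrix is \<open>w w\<^sup>T\<close> for the
  vector \<open>w = (z, 1)\<close>, and its quadratic form is the square \<open>(w \<bullet> x)\<^sup>2\<close>.\<close>

lemma outer_product_component: "outer_product x y $ i $ j = x $ i * y $ j"
  by (simp add: outer_product_def columnvector_def rowvector_def matrix_matrix_mult_def)

lemma outer_product_diff_diff:
  "outer_product (a - b) (c - d) =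
    outer_product a c - outer_product a d - outer_product b c + outer_product b d"
  by (simp add: vec_eq_iff outer_product_component algebra_simps)

lemma outer_product_nonneg:
  assumes "0 \<le> x" and "0 \<le> y"
  shows "0 \<le> outer_product x y"
  using assms by (simp add: less_eq_vec_def outer_product_component)

lemma outer_product_mult_vec: "outer_product x y *v v = (y \<bullet> v) *\<^sub>R x"
  by (simp add: vec_eq_iff matrix_vector_mult_def outer_product_component inner_vec_def
      sum_distrib_left mult_ac)

lemma outer_product_self_pos_semidef: "pos_semidef (outer_product x x)"
proof -
  have "transpose (outer_product x x) = outer_product x x"
    by (simp add: vec_eq_iff transpose_def outer_product_component mult.commute)
  moreover have "0 \<le> v \<bullet> (outer_product x x *v v)" for v
    by (simp add: outer_product_mult_vec inner_commute)
  ultimately show ?thesis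
    by (simp add: pos_semidef_def symmetric_matrices_def)
qed

text \<open>Appending the entry \<open>1\<close> to \<open>z\<close> homogenizes: the square of the extended vector carries
  \<open>z z\<^sup>T\<close>, \<open>z\<close> and the constant \<open>1\<close> in its blocks.\<close>

lemma block_matrix_eq_outer_product:
  fixes z :: "real ^ 'd"
  defines "w \<equiv> (\<chi> i. case i of Inl k \<Rightarrow> z $ k | Inr _ \<Rightarrow> 1) :: real ^ ('d + 1)"
  shows "block_matrix (outer_product z z) (columnvector z) (rowvector z) (mat 1) =
    outer_product w w"
  by (simp add: vec_eq_iff block_matrix_def w_def outer_product_component columnvector_def
      rowvector_def mat_def split: sum.split)

theorem proposition4p4:
  fixes l u :: "real ^ 'd"
  shows "lifted_set l u \<subseteq> relaxed_set l u"
proof (clarsimp simp: lifted_set_def relaxed_set_def, intro conjI)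
  fix z :: "real ^ 'd"
  assume "l \<le> z" and "z \<le> u"
  then have lz: "0 \<le> z - l" and zu: "0 \<le> u - z"
    by (simp_all add: less_eq_vec_def)
  show "0 \<le> outer_product u z - outer_product u l - outer_product z z + outer_product z l"
    using outer_product_nonneg[OF zu lz] by (simp add: outer_product_diff_diff)
  show "0 \<le> outer_product u u - outer_product u z - outer_product z u + outer_product z z"
    using outer_product_nonneg[OF zu zu] by (simp add: outer_product_diff_diff)
  show "0 \<le> outer_product z z - outer_product z l - outer_product l z + outer_product l l"
    using outer_product_nonneg[OF lz lz] by (simp add: outer_product_diff_diff)
  show "pos_semidef (block_matrix (outer_product z z) (columnvector z :: real ^ 1 ^ 'd)
      (rowvector z :: real ^ 'd ^ 1) (mat 1 :: real ^ 1 ^ 1))"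
    by (simp add: block_matrix_eq_outer_product outer_product_self_pos_semidef)
qed

end
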